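(* Let $K\ge 2$, $N\ge 2$ be integers and $p>0$. Let $\mathcal{L}$ be the generator of the Fleming-Viot process on the complete graph (given in the context), $\nu_N$ its unique (reversible) invariant probability measure and $(R_t)_{t\ge0}$ the semigroup generated by $\mathcal{L}$. Then the smallest positive eigenvalue $\lambda_1$ of $-\mathcal{L}$ is $\lambda_1=1$, and for every function $f:E\to\mathbb{R}$ and every $t\ge 0$, $$\|R_tf-\nu_N(f)\|_{L^2(\nu_N)}^2\le e^{-2t}\,\|f-\nu_N(f)\|_{L^2(\nu_N)}^2 .$$
   Context: $E=\{\eta:\{1,\dots,K\}\to\mathbb{N} : \sum_{i=1}^K\eta(i)=N\}$ with $\mathbb{N}=\{0,1,2,\dots\}$. For $\eta\in E$ with $\eta(i)\neq 0$ and $i\ne j$, $T_{i\to j}\eta$ is the configuration obtained by decreasing $\eta(i)$ by $1$ and increasing $\eta(j)$ by $1$, other coordinates unchanged; $T_{i\to i}\eta=\eta$. The generator acts on functions $f:E\to\mathbb{R}$ by $$\mathcal{L}f(\eta)=\sum_{i=1}^{K}\eta(i)\sum_{j=1}^{K}\bigl(f(T_{i\to j}\eta)-f(\eta)\bigr)\left(\frac1K+p\,\frac{\eta(j)}{N-1}\right).$$ The process is irreducible on the finite set $E$ and its unique invariant probability measure $\nu_N$ is reversible. $\nu_N(f)=\int f\,d\nu_N$. *)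

theory Defs
  imports "HOL-Probability.Probability_Mass_Function"
begin

definition configs :: "nat \<Rightarrow> nat \<Rightarrow> (nat \<Rightarrow> nat) set" where
  "configs K N = {\<eta> \<in> {1..K} \<rightarrow>\<^sub>E UNIV. (\<Sum>i=1..K. \<eta> i) = N}"

(* Meaningful only if i = j or \<eta> i > 0; in the generator below, the terms with \<eta> i = 0
   carry the factor \<eta> i. *)
definition move :: "nat \<Rightarrow> nat \<Rightarrow> (nat \<Rightarrow> nat) \<Rightarrow> (nat \<Rightarrow> nat)" where
  "move i j \<eta> = (if i = j then \<eta> else \<eta>(i := \<eta> i - 1, j := \<eta> j + 1))"

(* Functions on configs K N are represented by functions on the whole type nat \<Rightarrow> nat; at a point
   of configs K N, the generator depends only on the values of f on configs K N. *)
definition fv_generator ::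
  "nat \<Rightarrow> nat \<Rightarrow> real \<Rightarrow> ((nat \<Rightarrow> nat) \<Rightarrow> real) \<Rightarrow> (nat \<Rightarrow> nat) \<Rightarrow> real" where
  "fv_generator K N p f \<eta> =
     (\<Sum>i=1..K. real (\<eta> i) *
        (\<Sum>j=1..K. (f (move i j \<eta>) - f \<eta>) * (1 / real K + p * real (\<eta> j) / (real N - 1))))"

(* The exponential exp (t L) of the generator L, as a pointwise power series. It converges on
   configs K N, because that set is finite. *)
definition fv_semigroup ::
  "nat \<Rightarrow> nat \<Rightarrow> real \<Rightarrow> real \<Rightarrow> ((nat \<Rightarrow> nat) \<Rightarrow> real) \<Rightarrow> (nat \<Rightarrow> nat) \<Rightarrow> real" where
  "fv_semigroup K N p t f \<eta> = (\<Sum>n. t ^ n / fact n * (fv_generator K N p ^^ n) f \<eta>)"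

definition fv_invariant :: "nat \<Rightarrow> nat \<Rightarrow> real \<Rightarrow> (nat \<Rightarrow> nat) pmf \<Rightarrow> bool" where
  "fv_invariant K N p \<nu> \<longleftrightarrow>
     set_pmf \<nu> \<subseteq> configs K N \<and>
     (\<forall>f. \<forall>t\<ge>0. measure_pmf.expectation \<nu> (fv_semigroup K N p t f) = measure_pmf.expectation \<nu> f)"

definition neg_generator_eigenvalue :: "nat \<Rightarrow> nat \<Rightarrow> real \<Rightarrow> real \<Rightarrow> bool" where
  "neg_generator_eigenvalue K N p l \<longleftrightarrow>
     (\<exists>f. (\<exists>\<eta>\<in>configs K N. f \<eta> \<noteq> 0) \<and>
          (\<forall>\<eta>\<in>configs K N. - fv_generator K N p f \<eta> = l * f \<eta>))"

definition L2_norm_pmf :: "'a pmf \<Rightarrow> ('a \<Rightarrow> real) \<Rightarrow> real" where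
  "L2_norm_pmf \<nu> g = sqrt (measure_pmf.expectation \<nu> (\<lambda>x. (g x)\<^sup>2))"

end

(* Let M bound the differences f(z + e_i) - f(z + e_j), where z ranges over the configurations of
   N - 1 particles. Coupling the processes started from z + e_i and z + e_j shows that L contracts
   this Lipschitz constant at rate 1: the uniform jumps of the extra particle merge the two copies,
   and the expansion caused by particles that join the extra one is exactly compensated by the
   jumps of the extra particle onto occupied sites. So the Euler step P = 1 + s L multiplies M by
   1 - s for small s. As L is symmetric for the Dirichlet-multinomial weight w, the sequence |P^n g|^2
   is log-convex, which turns this asymptotic decay into |P g| <= (1 - s) |g| in L2(w) for centred g;
   letting s tend to 0 yields the Poincare inequality with constant 1. The decay of the semigroup
   follows by differentiating |R_t f - m|^2. It also forces R_t f to converge to a constant, hence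
   every invariant law is the normalised w. The eigenvalue 1 is attained at eta(1) - N/K. *)
theory Submission
  imports Defs
begin

section \<open>Configurations and single-particle moves\<close>

definition add_particle :: "nat \<Rightarrow> (nat \<Rightarrow> nat) \<Rightarrow> (nat \<Rightarrow> nat)" where
  "add_particle i \<zeta> = \<zeta>(i := \<zeta> i + 1)"

definition remove_particle :: "nat \<Rightarrow> (nat \<Rightarrow> nat) \<Rightarrow> (nat \<Rightarrow> nat)" where
  "remove_particle i \<zeta> = \<zeta>(i := \<zeta> i - 1)"

lemma add_particle_commute:
  "add_particle i (add_particle j \<zeta>) = add_particle j (add_particle i \<zeta>)"
  by (auto simp: add_particle_def fun_eq_iff)

lemma add_remove_particle: "\<zeta> i > 0 \<Longrightarrow> add_particle i (remove_particle i \<zeta>) = \<zeta>"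
  by (auto simp: add_particle_def remove_particle_def fun_eq_iff)

lemma move_eq_add_remove: "\<eta> k > 0 \<Longrightarrow> move k m \<eta> = add_particle m (remove_particle k \<eta>)"
  by (auto simp: add_particle_def remove_particle_def move_def fun_eq_iff)

lemma move_add_particle_self: "move i m (add_particle i \<zeta>) = add_particle m \<zeta>"
  by (auto simp: add_particle_def move_def fun_eq_iff)

lemma move_add_particle: "\<zeta> k > 0 \<Longrightarrow> move k m (add_particle i \<zeta>) = add_particle i (move k m \<zeta>)"
  by (auto simp: add_particle_def move_def fun_eq_iff)

lemma finite_configs [simp, intro]: "finite (configs K N)"
proof (rule finite_subset)
  show "configs K N \<subseteq> {1..K} \<rightarrow>\<^sub>E {..N}"
  proof
    fix \<eta> assume \<eta>: "\<eta> \<in> configs K N"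
    have "\<eta> i \<le> N" if "i \<in> {1..K}" for i
      using member_le_sum[of i "{1..K}" \<eta>] that \<eta> by (auto simp: configs_def)
    then show "\<eta> \<in> {1..K} \<rightarrow>\<^sub>E {..N}"
      using \<eta> by (auto simp: configs_def PiE_iff)
  qed
qed (auto intro: finite_PiE)

lemma add_particle_in_configs:
  assumes "\<zeta> \<in> configs K n" "i \<in> {1..K}"
  shows "add_particle i \<zeta> \<in> configs K (Suc n)"
proof -
  have "(\<Sum>k=1..K. add_particle i \<zeta> k) = (\<Sum>k=1..K. \<zeta> k + (if k = i then 1 else 0))"
    by (intro sum.cong) (auto simp: add_particle_def)
  also have "\<dots> = Suc n"
    using assms by (simp add: sum.distrib configs_def)
  finally show ?thesis
    using assms by (auto simp: configs_def add_particle_def PiE_iff extensional_def)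
qed

lemma remove_particle_in_configs:
  assumes "\<zeta> \<in> configs K n" "i \<in> {1..K}" "\<zeta> i > 0"
  shows "remove_particle i \<zeta> \<in> configs K (n - 1)" and "n > 0"
proof -
  have "n = (\<Sum>k=1..K. add_particle i (remove_particle i \<zeta>) k)"
    using assms by (simp add: add_remove_particle configs_def)
  also have "\<dots> = (\<Sum>k=1..K. remove_particle i \<zeta> k + (if k = i then 1 else 0))"
    by (intro sum.cong) (auto simp: add_particle_def)
  also have "\<dots> = (\<Sum>k=1..K. remove_particle i \<zeta> k) + 1"
    using assms by (simp add: sum.distrib)
  finally have eq: "n = (\<Sum>k=1..K. remove_particle i \<zeta> k) + 1" .
  then show "n > 0" by simp
  show "remove_particle i \<zeta> \<in> configs K (n - 1)"
    using assms eq by (auto simp: configs_def remove_particle_def PiE_iff extensional_def)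
qed

lemma move_in_configs:
  assumes "\<zeta> \<in> configs K n" "i \<in> {1..K}" "j \<in> {1..K}" "\<zeta> i > 0"
  shows "move i j \<zeta> \<in> configs K n"
  using add_particle_in_configs[OF remove_particle_in_configs(1)[OF assms(1,2,4)] assms(3)]
    remove_particle_in_configs(2)[OF assms(1,2,4)] assms(4)
  by (simp add: move_eq_add_remove)

lemma configs_SucE:
  assumes "\<eta> \<in> configs K (Suc n)"
  obtains i \<zeta> where "i \<in> {1..K}" "\<zeta> \<in> configs K n" "\<eta> = add_particle i \<zeta>"
proof -
  have "(\<Sum>i=1..K. \<eta> i) \<noteq> 0" using assms by (simp add: configs_def)
  then obtain i where i: "i \<in> {1..K}" "\<eta> i > 0" by (metis gr0I sum.neutral)
  show ?thesis
    by (rule that[of i "remove_particle i \<eta>"])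
      (use i assms remove_particle_in_configs(1)[OF assms i] in \<open>simp_all add: add_remove_particle\<close>)
qed

text \<open>Both configurations vanish on \<open>{1..K}\<close> and equal \<open>undefined\<close>
  elsewhere, by the extensionality built into \<open>configs\<close>.\<close>

lemma configs_0_unique:
  assumes "\<eta> \<in> configs K 0" "\<eta>' \<in> configs K 0"
  shows "\<eta> = \<eta>'"
proof
  fix x
  show "\<eta> x = \<eta>' x"
    using assms by (cases "x \<in> {1..K}") (auto simp: configs_def PiE_iff extensional_def)
qed

section \<open>Lipschitz functions on configurations\<close>

text \<open>Neighbouring configurations share \<open>N - 1\<close> particles and differ in the site
  of one more. No absolute value is needed, because all ordered pairs of sites occur.\<close>

definition lipschitz_configs ::
  "nat \<Rightarrow> nat \<Rightarrow> ((nat \<Rightarrow> nat) \<Rightarrow> real) \<Rightarrow> real \<Rightarrow> bool" where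
  "lipschitz_configs K N f M \<longleftrightarrow>
     (\<forall>\<zeta>\<in>configs K (N - 1). \<forall>i\<in>{1..K}. \<forall>j\<in>{1..K}.
        f (add_particle i \<zeta>) - f (add_particle j \<zeta>) \<le> M)"

lemma lipschitz_configs_oscillation:
  assumes "lipschitz_configs K N f M" "\<eta> \<in> configs K N" "\<eta>' \<in> configs K N"
  shows "f \<eta> - f \<eta>' \<le> real N * M"
  using assms
proof (induction N arbitrary: f \<eta> \<eta>')
  case 0
  then have "\<eta> = \<eta>'"
    by (intro configs_0_unique)
  then show ?case by simp
next
  case (Suc n)
  obtain i \<zeta> where 1: "i \<in> {1..K}" "\<zeta> \<in> configs K n" "\<eta> = add_particle i \<zeta>"
    using Suc.prems(2) by (rule configs_SucE)
  obtain j \<zeta>' where 2: "j \<in> {1..K}" "\<zeta>' \<in> configs K n" "\<eta>' = add_particle j \<zeta>'"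
    using Suc.prems(3) by (rule configs_SucE)
  have "f (add_particle i \<zeta>) - f (add_particle i \<zeta>') \<le> real n * M"
  \<comment> \<open>Since \<open>0 - 1 = 0\<close>, \<open>lipschitz_configs K 0\<close> would speak
    of one-particle configurations, on which the slice is not controlled. The case
    \<open>n = 0\<close> therefore bypasses the induction hypothesis.\<close>
  proof (cases n)
    case 0
    then show ?thesis using configs_0_unique[of \<zeta> K \<zeta>'] 1 2 by simp
  next
    case (Suc n')
    have "lipschitz_configs K n (\<lambda>\<xi>. f (add_particle i \<xi>)) M"
      unfolding lipschitz_configs_def
    proof (intro ballI)
      fix \<xi> a b assume *: "\<xi> \<in> configs K (n - 1)" "a \<in> {1..K}" "b \<in> {1..K}"
      have "add_particle i \<xi> \<in> configs K n"
        using add_particle_in_configs[OF *(1) 1(1)] Suc by simp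
      with Suc.prems(1) * show "f (add_particle i (add_particle a \<xi>)) - f (add_particle i (add_particle b \<xi>)) \<le> M"
        by (simp add: lipschitz_configs_def add_particle_commute[of i])
    qed
    then show ?thesis using Suc.IH 1 2 by blast
  qed
  moreover have "f (add_particle i \<zeta>') - f (add_particle j \<zeta>') \<le> M"
    using Suc.prems(1) 1 2 by (simp add: lipschitz_configs_def)
  ultimately show ?case using 1 2 by (simp add: algebra_simps)
qed

lemma lipschitz_configs_exists: "\<exists>M. lipschitz_configs K N f M"
proof -
  define d where "d = (\<lambda>(\<zeta>, i, j). f (add_particle i \<zeta>) - f (add_particle j \<zeta>))"
  define A where "A = configs K (N - 1) \<times> {1..K} \<times> {1..K}"
  have "finite A" by (simp add: A_def)
  then have *: "d x \<le> Max (d ` A)" if "x \<in> A" for x using that by simp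
  have "f (add_particle i \<zeta>) - f (add_particle j \<zeta>) \<le> Max (d ` A)"
    if "\<zeta> \<in> configs K (N - 1)" "i \<in> {1..K}" "j \<in> {1..K}" for \<zeta> i j
    using *[of "(\<zeta>, i, j)"] that by (simp add: d_def A_def)
  then show ?thesis unfolding lipschitz_configs_def by blast
qed

section \<open>Two inequalities for sequences and finite sums\<close>

text \<open>The ratios of consecutive terms are nondecreasing. If the first one, \<open>r\<close>,
  exceeded \<open>q\<close>, then \<open>u\<close> would grow at least like \<open>r ^ n\<close> and
  outrun \<open>B * q ^ n\<close>. The constant \<open>B\<close> thus disappears from the one-step
  estimate.\<close>

lemma log_convex_geometric_bound:
  fixes u :: "nat \<Rightarrow> real"
  assumes nonneg: "\<And>n. u n \<ge> 0" and lc: "\<And>n. (u (Suc n))\<^sup>2 \<le> u n * u (Suc (Suc n))"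
    and bound: "\<And>n. u n \<le> B * q ^ n" and q: "q > 0"
  shows "u 1 \<le> q * u 0"
proof (rule ccontr)
  assume "\<not> u 1 \<le> q * u 0"
  then have gt: "u 1 > q * u 0" by simp
  have u0: "u 0 > 0"
    using lc[of 0] gt nonneg[of 0] by (cases "u 0 = 0") auto
  define r where "r = u 1 / u 0"
  have r: "r > q" using gt u0 by (simp add: r_def field_simps)
  have step: "u n > 0 \<and> u (Suc n) \<ge> r * u n" for n
  proof (induction n)
    case 0
    then show ?case using u0 by (simp add: r_def)
  next
    case (Suc n)
    then have pos: "u (Suc n) > 0" using r q
      by (smt (verit) mult_pos_pos)
    have "(r * u (Suc n)) * u n \<le> u (Suc n) * u (Suc n)"
      using Suc pos by (simp add: mult.assoc mult.left_commute)
    also have "\<dots> \<le> u (Suc (Suc n)) * u n"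
      using lc[of n] by (simp add: power2_eq_square mult.commute)
    finally show ?case using Suc pos by simp
  qed
  have "r ^ n * u 0 \<le> u n" for n
  proof (induction n)
    case (Suc n)
    have "r ^ Suc n * u 0 \<le> r * u n" using Suc r q by simp
    also have "\<dots> \<le> u (Suc n)" using step by simp
    finally show ?case .
  qed simp
  then have "r ^ n * u 0 \<le> B * q ^ n" for n using bound order_trans by blast
  then have *: "(r / q) ^ n \<le> B / u 0" for n
    using u0 q by (simp add: field_simps power_divide)
  have "r / q > 1" using r q by simp
  then obtain n where "B / u 0 < (r / q) ^ n" using real_arch_pow by blast
  with *[of n] show False by simp
qed

lemma weighted_Cauchy_Schwarz:
  fixes w f g :: "'a \<Rightarrow> real"
  assumes "\<And>x. x \<in> A \<Longrightarrow> w x \<ge> 0"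
  shows "(\<Sum>x\<in>A. w x * f x * g x)\<^sup>2 \<le> (\<Sum>x\<in>A. w x * (f x)\<^sup>2) * (\<Sum>x\<in>A. w x * (g x)\<^sup>2)"
proof -
  have "(\<Sum>x\<in>A. (sqrt (w x) * f x) * (sqrt (w x) * g x))\<^sup>2 \<le>
      (\<Sum>x\<in>A. (sqrt (w x) * f x)\<^sup>2) * (\<Sum>x\<in>A. (sqrt (w x) * g x)\<^sup>2)"
    by (rule Cauchy_Schwarz_ineq_sum)
  moreover have "(\<Sum>x\<in>A. (sqrt (w x) * f x) * (sqrt (w x) * g x)) = (\<Sum>x\<in>A. w x * f x * g x)"
    by (intro sum.cong refl)
      (metis assms mult.assoc mult.commute real_sqrt_mult_self abs_of_nonneg)
  ultimately show ?thesis using assms by (simp add: power_mult_distrib)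
qed

section \<open>The generator and its action around an extra particle\<close>

locale fleming_viot =
  fixes K N :: nat and p :: real
  assumes K_ge_2: "K \<ge> 2" and N_ge_2: "N \<ge> 2" and p_pos: "p > 0"
begin

abbreviation S :: "(nat \<Rightarrow> nat) set" where "S \<equiv> configs K N"

abbreviation L :: "((nat \<Rightarrow> nat) \<Rightarrow> real) \<Rightarrow> (nat \<Rightarrow> nat) \<Rightarrow> real" where
  "L \<equiv> fv_generator K N p"

text \<open>Attraction per particle, normalised so that \<open>N - 1\<close> particles attract with
  total rate \<open>p\<close>.\<close>

definition \<beta> :: real where "\<beta> = p / (real N - 1)"

lemma \<beta>_pos: "\<beta> > 0"
  using p_pos N_ge_2 by (simp add: \<beta>_def)

lemma generator_eq:
  "L f \<eta> = (\<Sum>i=1..K. real (\<eta> i) *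
     (\<Sum>j=1..K. (f (move i j \<eta>) - f \<eta>) * (1 / real K + \<beta> * real (\<eta> j))))"
  by (simp add: fv_generator_def \<beta>_def)

lemma generator_linear: "L (\<lambda>\<xi>. a * f \<xi> + b * g \<xi>) \<eta> = a * L f \<eta> + b * L g \<eta>"
proof -
  have "a * L f \<eta> + b * L g \<eta> = (\<Sum>i=1..K. real (\<eta> i) *
     (\<Sum>j=1..K. a * ((f (move i j \<eta>) - f \<eta>) * (1 / real K + \<beta> * real (\<eta> j)))
       + b * ((g (move i j \<eta>) - g \<eta>) * (1 / real K + \<beta> * real (\<eta> j)))))"
    unfolding generator_eq
    by (simp add: sum.distrib sum_distrib_left[symmetric] distrib_left mult.left_commute[of a]
        mult.left_commute[of b] flip: sum_distrib_left)
      (simp add: sum_distrib_left mult.left_commute)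
  also have "\<dots> = L (\<lambda>\<xi>. a * f \<xi> + b * g \<xi>) \<eta>"
    unfolding generator_eq by (intro sum.cong refl arg_cong2[of _ _ _ _ "(*)"]) (simp add: algebra_simps)
  finally show ?thesis ..
qed

lemma generator_const: "L (\<lambda>\<xi>. c) \<eta> = 0"
  by (simp add: generator_eq)

(* The three sums: jumps of the particles of zeta in the environment zeta, jumps of the extra
   particle, and jumps of the particles of zeta onto the extra particle. *)
lemma generator_add_particle:
  assumes i: "i \<in> {1..K}"
  shows "L f (add_particle i \<zeta>) =
      (\<Sum>k=1..K. real (\<zeta> k) * (\<Sum>m=1..K. (f (add_particle i (move k m \<zeta>)) - f (add_particle i \<zeta>))
          * (1 / real K + \<beta> * real (\<zeta> m))))
    + (\<Sum>m=1..K. (f (add_particle m \<zeta>) - f (add_particle i \<zeta>)) * (1 / real K + \<beta> * real (\<zeta> m)))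
    + \<beta> * (\<Sum>k=1..K. real (\<zeta> k) *
        (f (add_particle i (add_particle i (remove_particle k \<zeta>))) - f (add_particle i \<zeta>)))"
proof -
  define c where "c m = 1 / real K + \<beta> * real (\<zeta> m)" for m
  define h where "h k m = f (move k m (add_particle i \<zeta>)) - f (add_particle i \<zeta>)" for k m
  define G where "G k = (\<Sum>m=1..K. h k m * (1 / real K + \<beta> * real (add_particle i \<zeta> m)))" for k
  \<comment> \<open>The extra particle changes only the rate of jumps towards its own site
    \<open>i\<close>, which grows by \<beta>.\<close>
  have G: "G k = (\<Sum>m=1..K. h k m * c m) + \<beta> * h k i" for k
  proof -
    have "G k = (\<Sum>m=1..K. h k m * c m + (if m = i then \<beta> * h k m else 0))"
      unfolding G_def by (intro sum.cong refl) (auto simp: add_particle_def c_def algebra_simps)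
    then show ?thesis using i by (simp add: sum.distrib)
  qed
  have "L f (add_particle i \<zeta>) = (\<Sum>k=1..K. real (add_particle i \<zeta> k) * G k)"
    by (simp add: generator_eq G_def h_def)
  also have "\<dots> = (\<Sum>k=1..K. real (\<zeta> k) * G k + (if k = i then G k else 0))"
    by (intro sum.cong refl) (auto simp: add_particle_def algebra_simps)
  also have "\<dots> = (\<Sum>k=1..K. real (\<zeta> k) * G k) + G i"
    using i by (simp add: sum.distrib)
  also have "G i = (\<Sum>m=1..K. (f (add_particle m \<zeta>) - f (add_particle i \<zeta>)) * c m)"
    by (simp add: G) (simp add: h_def move_add_particle_self)
  also have "(\<Sum>k=1..K. real (\<zeta> k) * G k) =
      (\<Sum>k=1..K. real (\<zeta> k) * (\<Sum>m=1..K. (f (add_particle i (move k m \<zeta>)) - f (add_particle i \<zeta>)) * c m)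
        + \<beta> * (real (\<zeta> k) *
        (f (add_particle i (add_particle i (remove_particle k \<zeta>))) - f (add_particle i \<zeta>))))"
  proof (intro sum.cong refl)
    fix k
    show "real (\<zeta> k) * G k =
      real (\<zeta> k) * (\<Sum>m=1..K. (f (add_particle i (move k m \<zeta>)) - f (add_particle i \<zeta>)) * c m)
        + \<beta> * (real (\<zeta> k) *
        (f (add_particle i (add_particle i (remove_particle k \<zeta>))) - f (add_particle i \<zeta>)))"
    proof (cases "\<zeta> k = 0")
      case False
      then have h: "h k m = f (add_particle i (move k m \<zeta>)) - f (add_particle i \<zeta>)" for m
        by (simp add: h_def move_add_particle)
      have "h k i = f (add_particle i (add_particle i (remove_particle k \<zeta>))) - f (add_particle i \<zeta>)"
        using False by (simp add: h move_eq_add_remove)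
      then show ?thesis
        unfolding G h[symmetric] by (simp only: distrib_left mult.left_commute)
    qed simp
  qed
  finally show ?thesis
    by (simp add: c_def sum.distrib sum_distrib_left add_ac)
qed

section \<open>Contraction of the Lipschitz constant\<close>

text \<open>The total coefficient of \<open>- D \<zeta>\<close> in the next estimate:
  \<open>(N - 1) * (1 + p)\<close> from the common jumps, \<open>1 + p\<close> from the jumps of the
  extra particle and \<open>p\<close> from the jumps onto it. The coefficient of \<open>M\<close>
  there is \<open>(N - 1) * (1 + p) + 2 * p\<close>, which is \<open>C - 1\<close>.\<close>

definition C :: real where "C = (real N - 1) * (1 + p) + 1 + 2 * p"

lemma C_pos: "C > 0"
  unfolding C_def using p_pos N_ge_2 by (intro add_nonneg_pos mult_nonneg_nonneg add_pos_pos) auto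

text \<open>At a pair of sites attaining \<open>M\<close> the right-hand side is \<open>- M\<close>,
  which is contraction at rate 1. The slack \<open>C * (M - D)\<close> covers the other pairs and is
  absorbed later by choosing the time step small.\<close>

lemma generator_contracts:
  assumes lip: "lipschitz_configs K N f M"
    and \<zeta>: "\<zeta> \<in> configs K (N - 1)" and i: "i \<in> {1..K}" and j: "j \<in> {1..K}"
  shows "L f (add_particle i \<zeta>) - L f (add_particle j \<zeta>)
    \<le> C * (M - (f (add_particle i \<zeta>) - f (add_particle j \<zeta>))) - M"
proof -
  define D where "D \<xi> = f (add_particle i \<xi>) - f (add_particle j \<xi>)" for \<xi>
  define c where "c m = 1 / real K + \<beta> * real (\<zeta> m)" for m
  have c_nonneg: "c m \<ge> 0" for m using \<beta>_pos by (simp add: c_def)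
  have D_le: "D \<xi> \<le> M" if "\<xi> \<in> configs K (N - 1)" for \<xi>
    using lip that i j by (simp add: D_def lipschitz_configs_def)
  have sum_\<zeta>: "(\<Sum>k=1..K. real (\<zeta> k)) = real N - 1"
    using \<zeta> N_ge_2 by (simp add: configs_def of_nat_diff flip: of_nat_sum)
  have sum_c: "(\<Sum>m=1..K. c m) = 1 + p"
    using sum_\<zeta> K_ge_2 N_ge_2
    by (simp only: c_def sum.distrib sum_distrib_left[symmetric]) (simp add: \<beta>_def)
  \<comment> \<open>\<open>?T1\<close> lets a particle of \<zeta> jump identically in both copies.
    In \<open>?T2\<close> the extra particles of both copies jump to the same site \<open>m\<close>,
    so the difference drops from \<open>D \<zeta>\<close> to 0. \<open>?T3\<close> collects the
    jumps onto the extra particle, whose target differs between the copies.\<close>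
  let ?T1 = "\<Sum>k=1..K. real (\<zeta> k) * (\<Sum>m=1..K. (D (move k m \<zeta>) - D \<zeta>) * c m)"
  let ?T2 = "\<Sum>m=1..K. (- D \<zeta>) * c m"
  let ?H = "\<lambda>k. f (add_particle i (add_particle i (remove_particle k \<zeta>)))
      - f (add_particle j (add_particle j (remove_particle k \<zeta>)))"
  let ?T3 = "\<beta> * (\<Sum>k=1..K. real (\<zeta> k) * (?H k - D \<zeta>))"
  have "L f (add_particle i \<zeta>) - L f (add_particle j \<zeta>) = ?T1 + ?T2 + ?T3"
  proof -
    have 1: "?T1 = (\<Sum>k=1..K. real (\<zeta> k) * (\<Sum>m=1..K. (f (add_particle i (move k m \<zeta>)) - f (add_particle i \<zeta>)) * c m))
        - (\<Sum>k=1..K. real (\<zeta> k) * (\<Sum>m=1..K. (f (add_particle j (move k m \<zeta>)) - f (add_particle j \<zeta>)) * c m))"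
      by (simp add: D_def algebra_simps sum_subtractf sum.distrib)
    have 2: "?T2 = (\<Sum>m=1..K. (f (add_particle m \<zeta>) - f (add_particle i \<zeta>)) * c m)
        - (\<Sum>m=1..K. (f (add_particle m \<zeta>) - f (add_particle j \<zeta>)) * c m)"
      unfolding sum_subtractf[symmetric] by (intro sum.cong refl) (simp add: D_def algebra_simps)
    have 3: "?T3 = \<beta> * (\<Sum>k=1..K. real (\<zeta> k) *
        (f (add_particle i (add_particle i (remove_particle k \<zeta>))) - f (add_particle i \<zeta>)))
       - \<beta> * (\<Sum>k=1..K. real (\<zeta> k) *
        (f (add_particle j (add_particle j (remove_particle k \<zeta>))) - f (add_particle j \<zeta>)))"
      unfolding right_diff_distrib[symmetric] sum_subtractf[symmetric]
      by (intro arg_cong2[of _ _ _ _ "(*)"] sum.cong refl) (simp add: D_def algebra_simps)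
    show ?thesis
      unfolding generator_add_particle[OF i] generator_add_particle[OF j] 1 2 3 by (simp add: c_def)
  qed
  also have "?T1 \<le> (\<Sum>k=1..K. real (\<zeta> k) * (\<Sum>m=1..K. (M - D \<zeta>) * c m))"
  proof (intro sum_mono)
    fix k assume k: "k \<in> {1..K}"
    show "real (\<zeta> k) * (\<Sum>m=1..K. (D (move k m \<zeta>) - D \<zeta>) * c m)
      \<le> real (\<zeta> k) * (\<Sum>m=1..K. (M - D \<zeta>) * c m)"
    proof (cases "\<zeta> k = 0")
      case False
      then have "D (move k m \<zeta>) \<le> M" if "m \<in> {1..K}" for m
        using move_in_configs[OF \<zeta> k that] by (intro D_le) simp
      then show ?thesis using c_nonneg by (intro mult_left_mono sum_mono mult_right_mono) auto
    qed simp
  qed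
  also have "\<dots> = (real N - 1) * ((M - D \<zeta>) * (1 + p))"
    by (simp only: sum_c sum_\<zeta> sum_distrib_left[symmetric] sum_distrib_right[symmetric])
  also have "?T2 = - D \<zeta> * (1 + p)"
    by (simp only: sum_c sum_distrib_left[symmetric])
  \<comment> \<open>After such a jump the copies differ by two particles. Passing through the
    configuration with one particle at \<open>i\<close> and one at \<open>j\<close> splits
    \<open>?H k\<close> into two values of \<open>D\<close>, hence the bound
    \<open>2 * M\<close>.\<close>
  also have "?T3 \<le> \<beta> * (\<Sum>k=1..K. real (\<zeta> k) * (2 * M - D \<zeta>))"
  proof (rule mult_left_mono[OF sum_mono])
    fix k assume k: "k \<in> {1..K}"
    show "real (\<zeta> k) * (?H k - D \<zeta>) \<le> real (\<zeta> k) * (2 * M - D \<zeta>)"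
    proof (cases "\<zeta> k = 0")
      case False
      let ?r = "remove_particle k \<zeta>"
      have r: "?r \<in> configs K (N - 1 - 1)"
        using remove_particle_in_configs(1)[OF \<zeta> k] False by simp
      have "add_particle i ?r \<in> configs K (N - 1)" "add_particle j ?r \<in> configs K (N - 1)"
        using add_particle_in_configs[OF r i] add_particle_in_configs[OF r j] N_ge_2
        by (simp_all add: numeral_2_eq_2 Suc_diff_Suc)
      then have "D (add_particle i ?r) \<le> M" "D (add_particle j ?r) \<le> M"
        by (auto intro: D_le)
      then have "?H k \<le> 2 * M"
        by (simp add: D_def add_particle_commute[of j i])
      then show ?thesis by (intro mult_left_mono) auto
    qed simp
  qed (use \<beta>_pos in auto)
  also have "\<dots> = p * (2 * M - D \<zeta>)"
    using N_ge_2 by (simp only: sum_\<zeta> sum_distrib_right[symmetric]) (simp add: \<beta>_def)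
  also have "(real N - 1) * ((M - D \<zeta>) * (1 + p)) + - D \<zeta> * (1 + p) + p * (2 * M - D \<zeta>) = C * (M - D \<zeta>) - M"
    by (simp add: C_def algebra_simps)
  finally show ?thesis by (simp add: D_def)
qed

(* Dirichlet-multinomial weights, unnormalised. *)
definition w :: "(nat \<Rightarrow> nat) \<Rightarrow> real" where
  "w \<eta> = (\<Prod>i=1..K. pochhammer (1 / (real K * \<beta>)) (\<eta> i) / fact (\<eta> i))"

lemma w_pos: "w \<eta> > 0"
  unfolding w_def using K_ge_2 \<beta>_pos by (intro prod_pos) (auto intro!: divide_pos_pos pochhammer_pos)

section \<open>Jump rates, detailed balance and symmetry\<close>

definition rate :: "(nat \<Rightarrow> nat) \<Rightarrow> nat \<Rightarrow> nat \<Rightarrow> real" where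
  "rate \<eta> i j = real (\<eta> i) * (1 / real K + \<beta> * real (\<eta> j))"

lemma generator_rate: "L f \<eta> = (\<Sum>i=1..K. \<Sum>j=1..K. rate \<eta> i j * (f (move i j \<eta>) - f \<eta>))"
  by (simp add: generator_eq rate_def sum_distrib_left mult_ac)

text \<open>Only the factors of \<open>w\<close> at \<open>i\<close> and \<open>j\<close> change.
  With \<open>a = 1 / (K * \<beta>)\<close> the rate is
  \<open>\<beta> * \<eta> i * (a + \<eta> j)\<close>, and the recursion \<open>v_Suc\<close> of the
  single-site weights, applied once at each of the two sites, exchanges the two sides.\<close>

lemma w_detailed_balance:
  assumes "i \<in> {1..K}" "j \<in> {1..K}" "\<eta> i > 0"
  shows "w (move i j \<eta>) * rate (move i j \<eta>) j i = w \<eta> * rate \<eta> i j"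
proof (cases "i = j")
  case True
  then show ?thesis by (simp add: move_def)
next
  case False
  define a where "a = 1 / (real K * \<beta>)"
  define v where "v n = pochhammer a n / fact n" for n
  have v_Suc: "v (Suc n) * real (Suc n) = v n * (a + real n)" for n
    by (simp add: v_def pochhammer_Suc field_simps del: of_nat_Suc)
  have rate_eq: "rate \<xi> k l = \<beta> * real (\<xi> k) * (a + real (\<xi> l))" for \<xi> k l
    using \<beta>_pos K_ge_2 by (simp add: rate_def a_def field_simps)
  let ?R = "\<lambda>\<xi>. \<Prod>k\<in>{1..K} - {i} - {j}. v (\<xi> k)"
  have w_eq: "w \<xi> = v (\<xi> i) * (v (\<xi> j) * ?R \<xi>)" for \<xi>
    unfolding w_def a_def[symmetric] v_def[symmetric] using assms False
    by (subst prod.remove[of _ i], simp, simp, subst prod.remove[of _ j]) auto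
  obtain n where n: "\<eta> i = Suc n" using assms(3) gr0_implies_Suc by blast
  have m: "move i j \<eta> i = n" "move i j \<eta> j = Suc (\<eta> j)" "?R (move i j \<eta>) = ?R \<eta>"
    using False n by (auto simp: move_def intro!: prod.cong)
  have "w (move i j \<eta>) * rate (move i j \<eta>) j i
      = \<beta> * ?R \<eta> * (v n * (a + real n)) * (v (Suc (\<eta> j)) * real (Suc (\<eta> j)))"
    unfolding w_eq rate_eq m by (simp only: mult_ac)
  also have "\<dots> = \<beta> * ?R \<eta> * (v (Suc n) * real (Suc n)) * (v (\<eta> j) * (a + real (\<eta> j)))"
    unfolding v_Suc ..
  also have "\<dots> = w \<eta> * rate \<eta> i j"
    unfolding w_eq rate_eq n by (simp only: mult_ac)
  finally show ?thesis .
qed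

text \<open>Reversing a jump is an involution on the admissible jumps, and by detailed balance it
  preserves their weights. It exchanges the roles of \<open>f\<close> and \<open>g\<close> in the
  gain term \<open>B\<close>; the loss term is symmetric already.\<close>

lemma generator_symmetric:
  "(\<Sum>\<eta>\<in>S. w \<eta> * f \<eta> * L g \<eta>) = (\<Sum>\<eta>\<in>S. w \<eta> * g \<eta> * L f \<eta>)"
proof -
  \<comment> \<open>Moves from an empty site are excluded because \<tau> does not invert them; their
    rate is 0, so the sums do not change.\<close>
  define X where "X = {(\<eta>, i, j). \<eta> \<in> S \<and> i \<in> {1..K} \<and> j \<in> {1..K} \<and> \<eta> i > 0}"
  define \<tau> where "\<tau> = (\<lambda>(\<eta>, i, j). (move i j \<eta>, j, i :: nat))"
  have \<tau>: "\<tau> x \<in> X" "\<tau> (\<tau> x) = x" if "x \<in> X" for x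
    using that move_in_configs by (auto simp: X_def \<tau>_def move_def fun_eq_iff)
  define B where "B f g = (\<Sum>\<eta>\<in>S. \<Sum>i=1..K. \<Sum>j=1..K. w \<eta> * rate \<eta> i j * f \<eta> * g (move i j \<eta>))"
    for f g :: "(nat \<Rightarrow> nat) \<Rightarrow> real"
  have B: "B f g = (\<Sum>(\<eta>, i, j)\<in>X. w \<eta> * rate \<eta> i j * f \<eta> * g (move i j \<eta>))" for f g
  proof -
    have "B f g = (\<Sum>(\<eta>, i, j)\<in>S \<times> {1..K} \<times> {1..K}. w \<eta> * rate \<eta> i j * f \<eta> * g (move i j \<eta>))"
      by (simp add: B_def sum.cartesian_product)
    also have "\<dots> = (\<Sum>(\<eta>, i, j)\<in>X. w \<eta> * rate \<eta> i j * f \<eta> * g (move i j \<eta>))"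
      by (rule sum.mono_neutral_right) (auto simp: X_def rate_def)
    finally show ?thesis .
  qed
  have B_sym: "B f g = B g f"
    unfolding B
  proof (rule sum.reindex_bij_witness[of X \<tau> \<tau>])
    fix x assume x: "x \<in> X"
    obtain \<eta> i j where eq: "x = (\<eta>, i, j)" by (cases x)
    from x eq have "i \<in> {1..K}" "j \<in> {1..K}" "\<eta> i > 0" by (auto simp: X_def)
    moreover from this have "move j i (move i j \<eta>) = \<eta>"
      by (auto simp: move_def fun_eq_iff)
    ultimately show "(case \<tau> x of (\<eta>, i, j) \<Rightarrow> w \<eta> * rate \<eta> i j * g \<eta> * f (move i j \<eta>))
        = (case x of (\<eta>, i, j) \<Rightarrow> w \<eta> * rate \<eta> i j * f \<eta> * g (move i j \<eta>))"
      using w_detailed_balance[of i j \<eta>] by (simp add: eq \<tau>_def)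
  qed (use \<tau> in auto)
  have "(\<Sum>\<eta>\<in>S. w \<eta> * f \<eta> * L g \<eta>) =
      B f g - (\<Sum>\<eta>\<in>S. \<Sum>i=1..K. \<Sum>j=1..K. w \<eta> * rate \<eta> i j * (f \<eta> * g \<eta>))" for f g
    unfolding B_def generator_rate sum_distrib_left sum_subtractf[symmetric]
    by (intro sum.cong refl) (simp add: algebra_simps)
  then show ?thesis by (simp add: B_sym mult.commute)
qed

section \<open>The weighted inner product and centred functions\<close>

definition ip :: "((nat \<Rightarrow> nat) \<Rightarrow> real) \<Rightarrow> ((nat \<Rightarrow> nat) \<Rightarrow> real) \<Rightarrow> real" where
  "ip f g = (\<Sum>\<eta>\<in>S. w \<eta> * f \<eta> * g \<eta>)"

definition Z :: real where "Z = (\<Sum>\<eta>\<in>S. w \<eta>)"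

text \<open>A witness with two uses: \<open>S\<close> is nonempty, and the eigenfunction for the
  eigenvalue 1 does not vanish identically.\<close>

lemma concentrated_config: "(\<lambda>i\<in>{1..K}. if i = 1 then N else 0) \<in> S"
  using K_ge_2 by (auto simp: configs_def)

lemma Z_pos: "Z > 0"
  unfolding Z_def using concentrated_config w_pos by (intro sum_pos) auto

lemma ip_nonneg: "ip f f \<ge> 0"
  unfolding ip_def using w_pos
  by (intro sum_nonneg) (simp add: mult.assoc less_imp_le)

lemma ip_pos:
  assumes "\<eta> \<in> S" "f \<eta> \<noteq> 0"
  shows "ip f f > 0"
  unfolding ip_def
proof (rule sum_pos2[OF finite_configs assms(1)])
  show "w \<eta> * f \<eta> * f \<eta> > 0"
    using assms(2) w_pos[of \<eta>] by (simp add: mult.assoc flip: power2_eq_square)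
qed (use w_pos in \<open>simp add: mult.assoc less_imp_le\<close>)

lemma ip_commute: "ip f g = ip g f"
  by (simp add: ip_def mult_ac)

lemma ip_add_scale_right: "ip f (\<lambda>\<xi>. g \<xi> + s * h \<xi>) = ip f g + s * ip f h"
  by (simp add: ip_def algebra_simps sum.distrib sum_distrib_left)

lemma ip_add_scale_left: "ip (\<lambda>\<xi>. g \<xi> + s * h \<xi>) f = ip g f + s * ip h f"
  by (simp add: ip_commute[of _ f] ip_add_scale_right)

lemma ip_generator: "ip f (L g) = ip g (L f)"
  unfolding ip_def by (rule generator_symmetric)

text \<open>Stationarity of \<open>w\<close>: symmetry moves \<open>L\<close> onto the constant 1,
  which it annihilates.\<close>

lemma ip_one_generator: "ip (\<lambda>_. 1) (L f) = 0"
  by (subst ip_generator) (simp add: ip_def generator_const)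

text \<open>For centred \<open>h\<close>, the value \<open>h \<eta>\<close> is the weighted mean of
  the differences \<open>h \<eta> - h \<xi>\<close>, each bounded by the oscillation.\<close>

lemma mean_zero_bound:
  assumes "lipschitz_configs K N h M" "ip (\<lambda>_. 1) h = 0" "\<eta> \<in> S"
  shows "\<bar>h \<eta>\<bar> \<le> real N * M"
proof -
  have "Z * h \<eta> = (\<Sum>\<xi>\<in>S. w \<xi> * (h \<eta> - h \<xi>))"
    using assms(2) by (simp add: Z_def ip_def right_diff_distrib sum_subtractf sum_distrib_right)
  also have "\<dots> \<le> (\<Sum>\<xi>\<in>S. w \<xi> * (real N * M))"
    using w_pos lipschitz_configs_oscillation[OF assms(1,3)]
    by (intro sum_mono mult_left_mono) (auto intro: less_imp_le)
  also have "\<dots> = Z * (real N * M)" by (simp add: Z_def sum_distrib_right)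
  finally have 1: "h \<eta> \<le> real N * M" using Z_pos by simp
  have "Z * (- h \<eta>) = (\<Sum>\<xi>\<in>S. w \<xi> * (h \<xi> - h \<eta>))"
    using assms(2) by (simp add: Z_def ip_def right_diff_distrib sum_subtractf sum_distrib_right)
  also have "\<dots> \<le> (\<Sum>\<xi>\<in>S. w \<xi> * (real N * M))"
    using w_pos lipschitz_configs_oscillation[OF assms(1) _ assms(3)]
    by (intro sum_mono mult_left_mono) (auto intro: less_imp_le)
  also have "\<dots> = Z * (real N * M)" by (simp add: Z_def sum_distrib_right)
  finally have 2: "- h \<eta> \<le> real N * M" using Z_pos by (simp only: mult_le_cancel_left_pos)
  from 1 2 show ?thesis by simp
qed

section \<open>Euler steps and the Poincare inequality\<close>

definition euler_step :: "real \<Rightarrow> ((nat \<Rightarrow> nat) \<Rightarrow> real) \<Rightarrow> (nat \<Rightarrow> nat) \<Rightarrow> real" where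
  "euler_step s f = (\<lambda>\<xi>. f \<xi> + s * L f \<xi>)"

text \<open>A difference \<open>D\<close> becomes at most
  \<open>(1 - s) * M - (1 - s * C) * (M - D)\<close>; the condition on \<open>s * C\<close> makes
  the subtracted term nonnegative.\<close>

lemma euler_step_lipschitz:
  assumes "lipschitz_configs K N f M" "s \<ge> 0" "s * C \<le> 1"
  shows "lipschitz_configs K N (euler_step s f) ((1 - s) * M)"
  unfolding lipschitz_configs_def
proof (intro ballI)
  fix \<zeta> i j assume *: "\<zeta> \<in> configs K (N - 1)" "i \<in> {1..K}" "j \<in> {1..K}"
  define D where "D = f (add_particle i \<zeta>) - f (add_particle j \<zeta>)"
  have "D \<le> M" using assms(1) * by (simp add: D_def lipschitz_configs_def)
  have "euler_step s f (add_particle i \<zeta>) - euler_step s f (add_particle j \<zeta>)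
      = D + s * (L f (add_particle i \<zeta>) - L f (add_particle j \<zeta>))"
    by (simp add: euler_step_def D_def algebra_simps)
  also have "\<dots> \<le> D + s * (C * (M - D) - M)"
    using generator_contracts[OF assms(1) *] assms(2) by (auto simp: D_def intro: mult_left_mono)
  also have "\<dots> = (1 - s) * M - (1 - s * C) * (M - D)" by (simp add: algebra_simps)
  also have "\<dots> \<le> (1 - s) * M" using \<open>D \<le> M\<close> assms(3) by simp
  finally show "euler_step s f (add_particle i \<zeta>) - euler_step s f (add_particle j \<zeta>) \<le> (1 - s) * M" .
qed

lemma ip_euler_step: "ip (euler_step s f) g = ip f (euler_step s g)"
  by (simp add: euler_step_def ip_add_scale_left ip_add_scale_right ip_generator[of f]
      ip_commute[of "L f"])

lemma ip_one_euler_step: "ip (\<lambda>_. 1) (euler_step s f) = ip (\<lambda>_. 1) f"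
  by (simp add: euler_step_def ip_add_scale_right ip_one_generator)

lemma euler_step_L2_contraction:
  assumes mean: "ip (\<lambda>_. 1) g = 0" and s: "0 < s" "s < 1" "s * C \<le> 1"
  shows "ip (euler_step s g) (euler_step s g) \<le> (1 - s)\<^sup>2 * ip g g"
proof -
  define P where "P n = (euler_step s ^^ n) g" for n
  define u where "u n = ip (P n) (P n)" for n
  obtain M where M: "lipschitz_configs K N g M" using lipschitz_configs_exists by blast
  have P_Suc: "P (Suc n) = euler_step s (P n)" for n by (simp add: P_def)
  have lip: "lipschitz_configs K N (P n) ((1 - s) ^ n * M)" for n
  proof (induction n)
    case 0
    then show ?case using M by (simp add: P_def)
  next
    case (Suc n)
    then show ?case using euler_step_lipschitz[OF Suc, of s] s by (simp add: P_Suc mult.assoc)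
  qed
  have P_mean: "ip (\<lambda>_. 1) (P n) = 0" for n
    by (induction n) (simp_all add: P_Suc ip_one_euler_step, simp add: P_def mean)
  have power_square_swap: "((1 - s)\<^sup>2) ^ n = ((1 - s) ^ n)\<^sup>2" for n
    by (simp only: power_mult[symmetric] mult.commute)
  have "u 1 \<le> (1 - s)\<^sup>2 * u 0"
  proof (rule log_convex_geometric_bound)
    fix n
    show "u n \<ge> 0" by (simp add: u_def ip_nonneg)
    \<comment> \<open>Symmetry shifts one Euler step from the left factor to the right one, so that
      Cauchy-Schwarz yields log-convexity.\<close>
    have "(u (Suc n))\<^sup>2 = (ip (P n) (P (Suc (Suc n))))\<^sup>2"
      by (simp add: u_def P_Suc ip_euler_step)
    also have "\<dots> \<le> u n * u (Suc (Suc n))"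
      using weighted_Cauchy_Schwarz[of S w "P n" "P (Suc (Suc n))"] w_pos
      by (simp add: ip_def u_def less_imp_le power2_eq_square mult.assoc)
    finally show "(u (Suc n))\<^sup>2 \<le> u n * u (Suc (Suc n))" .
    \<comment> \<open>The Lipschitz constant of \<open>P n\<close> decays like
      \<open>(1 - s) ^ n\<close> and bounds the centred function \<open>P n\<close> uniformly; the
      prefactor may be large, as only the rate matters.\<close>
    have "u n = (\<Sum>\<eta>\<in>S. w \<eta> * \<bar>P n \<eta>\<bar>\<^sup>2)"
      by (simp add: u_def ip_def power2_eq_square mult.assoc)
    also have "\<dots> \<le> (\<Sum>\<eta>\<in>S. w \<eta> * (real N * ((1 - s) ^ n * M))\<^sup>2)"
      using w_pos mean_zero_bound[OF lip P_mean]
      by (intro sum_mono mult_left_mono power_mono) (auto intro: less_imp_le)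
    also have "\<dots> = Z * (real N * ((1 - s) ^ n * M))\<^sup>2"
      by (simp only: Z_def sum_distrib_right)
    also have "\<dots> = (Z * (real N * M)\<^sup>2) * ((1 - s)\<^sup>2) ^ n"
      by (simp add: power_mult_distrib power_square_swap)
    finally show "u n \<le> (Z * (real N * M)\<^sup>2) * ((1 - s)\<^sup>2) ^ n" .
    show "(1 - s)\<^sup>2 > 0" using s by simp
  qed
  then show ?thesis by (simp add: u_def P_def)
qed

lemma poincare:
  assumes mean: "ip (\<lambda>_. 1) g = 0"
  shows "ip g (L g) \<le> - ip g g"
proof (rule ccontr)
  define q where "q = ip g g"
  (* The L2 contraction gives 2 (e - q) <= (s - 2) q for every small step size s. *)
  define e where "e = ip g (L g) + q"
  assume "\<not> ip g (L g) \<le> - ip g g"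
  then have e: "e > 0" by (simp add: e_def q_def)
  have q: "q \<ge> 0" by (simp add: q_def ip_nonneg)
  \<comment> \<open>The three bounds give \<open>s < 1\<close>, \<open>s * C \<le> 1\<close> and
    \<open>s * q < e\<close>; the last contradicts \<open>2 * e \<le> s * q\<close>. The denominator
    \<open>q + 1\<close> avoids dividing by 0.\<close>
  define s where "s = min (1 / 2) (min (1 / C) (e / (q + 1)))"
  have s: "0 < s" "s < 1" using e q C_pos by (auto simp: s_def)
  have "s \<le> 1 / C" "s \<le> e / (q + 1)" by (auto simp: s_def)
  then have s': "s * C \<le> 1" "s * (q + 1) \<le> e" using C_pos q by (simp_all add: pos_le_divide_eq)
  have "ip (euler_step s g) (euler_step s g) = q + 2 * s * (e - q) + s\<^sup>2 * ip (L g) (L g)"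
    by (simp add: euler_step_def ip_add_scale_left ip_add_scale_right ip_commute[of "L g" g]
        q_def e_def power2_eq_square algebra_simps)
  with euler_step_L2_contraction[OF mean s s'(1)]
  have "q + 2 * s * (e - q) + s\<^sup>2 * ip (L g) (L g) \<le> (1 - s)\<^sup>2 * q" by (simp add: q_def)
  moreover have "s\<^sup>2 * ip (L g) (L g) \<ge> 0" by (simp add: ip_nonneg)
  ultimately have "q + 2 * s * (e - q) \<le> (1 - s)\<^sup>2 * q" by linarith
  then have "s * (2 * e) \<le> s * (s * q)" by (simp add: power2_eq_square algebra_simps)
  then have "2 * e \<le> s * q" using s by simp
  then show False using s'(2) e s by (simp add: algebra_simps)
qed

section \<open>The smallest positive eigenvalue\<close>

text \<open>Pairing the eigenvalue equation with 1 gives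
  \<open>l * ip (\<lambda>_. 1) f = 0\<close>. Hence \<open>l > 0\<close> makes the eigenfunction
  centred, and the Poincare inequality applies to it.\<close>

lemma eigenvalue_ge_1:
  assumes "neg_generator_eigenvalue K N p l" "l > 0"
  shows "l \<ge> 1"
proof -
  obtain f \<eta> where \<eta>: "\<eta> \<in> S" "f \<eta> \<noteq> 0" and ev: "\<And>\<xi>. \<xi> \<in> S \<Longrightarrow> L f \<xi> = - (l * f \<xi>)"
    using assms(1) unfolding neg_generator_eigenvalue_def by force
  have ip_ev: "ip g (L f) = - l * ip g f" for g
    unfolding ip_def sum_distrib_left by (intro sum.cong refl) (simp add: ev)
  have "ip (\<lambda>_. 1) f = 0"
    using ip_ev[of "\<lambda>_. 1"] assms(2) by (simp add: ip_one_generator)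
  from poincare[OF this] have "ip f f \<le> l * ip f f" by (simp add: ip_ev)
  then show ?thesis using ip_pos[of \<eta> f] \<eta> by simp
qed

text \<open>Inflow into site 1 minus outflow from it: the attraction contributes
  \<open>\<beta> * N * \<eta> 1\<close> to both and cancels, which leaves the uniform jumps
  only.\<close>

lemma generator_occupation:
  assumes \<eta>: "\<eta> \<in> S"
  shows "L (\<lambda>\<xi>. real (\<xi> 1) - real N / real K) \<eta> = real N / real K - real (\<eta> 1)"
proof -
  let ?f = "\<lambda>\<xi> :: nat \<Rightarrow> nat. real (\<xi> 1) - real N / real K"
  have sum_\<eta>: "(\<Sum>k=1..K. real (\<eta> k)) = real N"
    using \<eta> by (simp add: configs_def flip: of_nat_sum)
  have "L ?f \<eta> = (\<Sum>i=1..K. \<Sum>j=1..K. (if j = 1 then rate \<eta> i j else 0) - (if i = 1 then rate \<eta> i j else 0))"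
    unfolding generator_rate
  proof (intro sum.cong refl)
    fix i j
    show "rate \<eta> i j * (?f (move i j \<eta>) - ?f \<eta>) = (if j = 1 then rate \<eta> i j else 0) - (if i = 1 then rate \<eta> i j else 0)"
      by (cases "\<eta> i = 0") (auto simp: rate_def move_def)
  qed
  also have "\<dots> = (\<Sum>i=1..K. rate \<eta> i 1) - (\<Sum>j=1..K. rate \<eta> 1 j)"
  proof -
    have "(\<Sum>i=1..K. \<Sum>j=1..K. if i = 1 then rate \<eta> i j else 0) = (\<Sum>j=1..K. rate \<eta> 1 j)"
      using K_ge_2 by (subst sum.swap) simp
    moreover have "(\<Sum>i=1..K. \<Sum>j=1..K. if j = 1 then rate \<eta> i j else 0) = (\<Sum>i=1..K. rate \<eta> i 1)"
      using K_ge_2 by simp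
    ultimately show ?thesis by (simp only: sum_subtractf)
  qed
  also have "(\<Sum>i=1..K. rate \<eta> i 1) = real N * (1 / real K + \<beta> * real (\<eta> 1))"
    by (simp only: rate_def sum_\<eta> sum_distrib_right[symmetric])
  also have "(\<Sum>j=1..K. rate \<eta> 1 j) = real (\<eta> 1) * (1 + \<beta> * real N)"
    using K_ge_2 sum_\<eta> by (simp add: rate_def sum.distrib flip: sum_distrib_left)
  finally show ?thesis by (simp add: algebra_simps)
qed

lemma eigenvalue_1: "neg_generator_eigenvalue K N p 1"
proof -
  let ?f = "\<lambda>\<xi> :: nat \<Rightarrow> nat. real (\<xi> 1) - real N / real K"
  have "?f (\<lambda>i\<in>{1..K}. if i = 1 then N else 0) \<noteq> 0"
    using K_ge_2 N_ge_2 by (simp add: field_simps)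
  then have "\<exists>\<eta>\<in>S. ?f \<eta> \<noteq> 0" using concentrated_config by blast
  moreover have "\<forall>\<eta>\<in>S. - L ?f \<eta> = 1 * ?f \<eta>"
    by (simp add: generator_occupation del: One_nat_def)
  ultimately show ?thesis
    unfolding neg_generator_eigenvalue_def by (intro exI[of _ ?f] conjI)
qed

section \<open>The semigroup as a power series and its decay\<close>

text \<open>\<open>L\<close> is a finite sum of evaluations, so it commutes with series converging
  on \<open>S\<close>. A move may leave \<open>S\<close> only if the site is empty, where the rate
  is 0.\<close>

lemma generator_sums:
  assumes "\<eta> \<in> S" "\<And>\<xi>. \<xi> \<in> S \<Longrightarrow> (\<lambda>n. a n \<xi>) sums g \<xi>"
  shows "(\<lambda>n. L (a n) \<eta>) sums L g \<eta>"
  unfolding generator_rate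
proof (intro sums_sum)
  fix i j assume ij: "i \<in> {1..K}" "j \<in> {1..K}"
  show "(\<lambda>n. rate \<eta> i j * (a n (move i j \<eta>) - a n \<eta>)) sums (rate \<eta> i j * (g (move i j \<eta>) - g \<eta>))"
  proof (cases "\<eta> i = 0")
    case True
    then show ?thesis by (simp add: rate_def)
  next
    case False
    then show ?thesis using ij assms move_in_configs[of \<eta> K N i j]
      by (intro sums_mult sums_diff) auto
  qed
qed

lemma generator_bounded:
  obtains B where "\<And>f A \<eta>. (\<And>\<xi>. \<xi> \<in> S \<Longrightarrow> \<bar>f \<xi>\<bar> \<le> A) \<Longrightarrow> \<eta> \<in> S \<Longrightarrow> \<bar>L f \<eta>\<bar> \<le> B * A"
proof (rule that)
  fix f :: "(nat \<Rightarrow> nat) \<Rightarrow> real" and A :: real and \<eta> assume f: "\<And>\<xi>. \<xi> \<in> S \<Longrightarrow> \<bar>f \<xi>\<bar> \<le> A" and \<eta>: "\<eta> \<in> S"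
  let ?b = "\<lambda>\<xi>. \<Sum>i=1..K. \<Sum>j=1..K. 2 * rate \<xi> i j"
  have rate_nonneg: "rate \<xi> i j \<ge> 0" for \<xi> i j using \<beta>_pos by (simp add: rate_def)
  have A: "A \<ge> 0" using f[OF \<eta>] by simp
  have "\<bar>L f \<eta>\<bar> \<le> (\<Sum>i=1..K. \<Sum>j=1..K. \<bar>rate \<eta> i j * (f (move i j \<eta>) - f \<eta>)\<bar>)"
    unfolding generator_rate by (intro order.trans[OF sum_abs] sum_mono sum_abs)
  also have "\<dots> \<le> (\<Sum>i=1..K. \<Sum>j=1..K. 2 * rate \<eta> i j * A)"
  proof (intro sum_mono)
    fix i j assume ij: "i \<in> {1..K}" "j \<in> {1..K}"
    show "\<bar>rate \<eta> i j * (f (move i j \<eta>) - f \<eta>)\<bar> \<le> 2 * rate \<eta> i j * A"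
    proof (cases "\<eta> i = 0")
      case True
      then show ?thesis by (simp add: rate_def)
    next
      case False
      then have "\<bar>f (move i j \<eta>) - f \<eta>\<bar> \<le> 2 * A"
        using f[OF move_in_configs[OF \<eta> ij]] f[OF \<eta>] by simp
      from mult_left_mono[OF this rate_nonneg[of \<eta> i j]] show ?thesis
        using rate_nonneg by (simp add: abs_mult mult_ac)
    qed
  qed
  also have "\<dots> = ?b \<eta> * A" by (simp add: sum_distrib_right)
  \<comment> \<open>Summing the rates over all of \<open>S\<close> is crude but makes the bound
    independent of \<eta>.\<close>
  also have "\<dots> \<le> (\<Sum>\<xi>\<in>S. ?b \<xi>) * A"
    using rate_nonneg \<eta> A by (intro mult_right_mono member_le_sum sum_nonneg) auto
  finally show "\<bar>L f \<eta>\<bar> \<le> (\<Sum>\<xi>\<in>S. ?b \<xi>) * A" .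
qed

abbreviation R :: "real \<Rightarrow> ((nat \<Rightarrow> nat) \<Rightarrow> real) \<Rightarrow> (nat \<Rightarrow> nat) \<Rightarrow> real" where
  "R \<equiv> fv_semigroup K N p"

lemma semigroup_eq: "R t f \<eta> = (\<Sum>n. (L ^^ n) f \<eta> / fact n * t ^ n)"
  by (simp add: fv_semigroup_def mult_ac)

lemma semigroup_summable:
  assumes \<eta>: "\<eta> \<in> S"
  shows "summable (\<lambda>n. (L ^^ n) f \<eta> / fact n * t ^ n)"
proof -
  obtain B where B: "\<And>f A \<eta>. (\<And>\<xi>. \<xi> \<in> S \<Longrightarrow> \<bar>f \<xi>\<bar> \<le> A) \<Longrightarrow> \<eta> \<in> S \<Longrightarrow> \<bar>L f \<eta>\<bar> \<le> B * A"
    using generator_bounded by blast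
  define A where "A = (\<Sum>\<xi>\<in>S. \<bar>f \<xi>\<bar>)"
  have bound: "\<bar>(L ^^ n) f \<xi>\<bar> \<le> B ^ n * A" if "\<xi> \<in> S" for n \<xi>
    using that
  proof (induction n arbitrary: \<xi>)
    case 0
    then show ?case using member_le_sum[of \<xi> S "\<lambda>\<xi>. \<bar>f \<xi>\<bar>"] by (simp add: A_def)
  next
    case (Suc n)
    then show ?case using B[of "(L ^^ n) f" "B ^ n * A" \<xi>] by (simp add: mult.assoc)
  qed
  \<comment> \<open>Since \<open>L\<close> is bounded by \<open>B\<close> in the supremum norm on
    \<open>S\<close>, the series is dominated by that of
    \<open>A * exp (B * \<bar>t\<bar>)\<close>.\<close>
  have "summable (\<lambda>n. A * (inverse (fact n) * (B * \<bar>t\<bar>) ^ n))"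
    by (intro summable_mult summable_exp)
  then show ?thesis
  proof (rule summable_comparison_test')
    fix n
    have "norm ((L ^^ n) f \<eta> / fact n * t ^ n) = \<bar>(L ^^ n) f \<eta>\<bar> * (\<bar>t\<bar> ^ n / fact n)"
      by (simp add: abs_mult power_abs)
    also have "\<dots> \<le> (B ^ n * A) * (\<bar>t\<bar> ^ n / fact n)"
      using bound[OF \<eta>] by (intro mult_right_mono) auto
    finally show "norm ((L ^^ n) f \<eta> / fact n * t ^ n) \<le> A * (inverse (fact n) * (B * \<bar>t\<bar>) ^ n)"
      by (simp add: power_mult_distrib field_simps)
  qed
qed

lemma semigroup_0: "R 0 f \<eta> = f \<eta>"
  unfolding semigroup_eq by (subst powser_zero) simp

text \<open>Termwise differentiation shifts the coefficients by one power of \<open>L\<close>, and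
  \<open>generator_sums\<close> takes that \<open>L\<close> out of the series.\<close>

lemma semigroup_deriv:
  assumes \<eta>: "\<eta> \<in> S"
  shows "((\<lambda>t. R t f \<eta>) has_real_derivative L (R t f) \<eta>) (at t)"
proof -
  let ?c = "\<lambda>\<xi> n. (L ^^ n) f \<xi> / fact n"
  have "(\<lambda>n. L (\<lambda>\<xi>. ?c \<xi> n * t ^ n) \<eta>) sums L (R t f) \<eta>"
    by (rule generator_sums[OF \<eta>]) (unfold semigroup_eq, rule summable_sums[OF semigroup_summable])
  also have "(\<lambda>n. L (\<lambda>\<xi>. ?c \<xi> n * t ^ n) \<eta>) = (\<lambda>n. diffs (?c \<eta>) n * t ^ n)"
  proof
    fix n
    \<comment> \<open>The summand with factor 0 only provides the shape required by
      \<open>generator_linear\<close>.\<close>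
    have "L (\<lambda>\<xi>. ?c \<xi> n * t ^ n) \<eta> = L (\<lambda>\<xi>. (t ^ n / fact n) * (L ^^ n) f \<xi> + 0 * f \<xi>) \<eta>"
      by (simp add: mult_ac)
    also have "\<dots> = diffs (?c \<eta>) n * t ^ n"
      by (subst generator_linear) (simp add: diffs_def field_simps del: of_nat_Suc)
    finally show "L (\<lambda>\<xi>. ?c \<xi> n * t ^ n) \<eta> = diffs (?c \<eta>) n * t ^ n" .
  qed
  finally have "(\<Sum>n. diffs (?c \<eta>) n * t ^ n) = L (R t f) \<eta>" by (simp add: sums_iff)
  with termdiffs_strong_converges_everywhere[OF semigroup_summable[OF \<eta>], of f t]
  show ?thesis by (simp add: semigroup_eq)
qed

lemma semigroup_mean: "ip (\<lambda>_. 1) (R t f) = ip (\<lambda>_. 1) f"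
proof -
  have "((\<lambda>t. ip (\<lambda>_. 1) (R t f)) has_real_derivative 0) (at t)" for t
  proof -
    have "((\<lambda>t. ip (\<lambda>_. 1) (R t f)) has_real_derivative ip (\<lambda>_. 1) (L (R t f))) (at t)"
      unfolding ip_def by (intro DERIV_sum DERIV_cmult semigroup_deriv)
    then show ?thesis by (simp add: ip_one_generator)
  qed
  then have "ip (\<lambda>_. 1) (R t f) = ip (\<lambda>_. 1) (R 0 f)"
    by (intro DERIV_isconst_all) blast
  then show ?thesis by (simp add: ip_def semigroup_0)
qed

text \<open>For the centred function \<open>v\<close>, the derivative of its squared norm
  \<open>h\<close> is \<open>2 * ip v (L v)\<close>, at most \<open>- 2 * h\<close> by the Poincare
  inequality; so \<open>exp (2 * t) * h t\<close> is nonincreasing.\<close>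

lemma semigroup_decay:
  fixes f
  defines "m \<equiv> ip (\<lambda>_. 1) f / Z"
  assumes t: "t \<ge> 0"
  shows "(\<Sum>\<eta>\<in>S. w \<eta> * (R t f \<eta> - m)\<^sup>2) \<le> exp (- 2 * t) * (\<Sum>\<eta>\<in>S. w \<eta> * (f \<eta> - m)\<^sup>2)"
proof -
  define h where "h t = (\<Sum>\<eta>\<in>S. w \<eta> * (R t f \<eta> - m)\<^sup>2)" for t
  have "exp (2 * t) * h t \<le> exp (2 * 0) * h 0"
  proof (rule DERIV_nonpos_imp_nonincreasing[OF t])
    fix t :: real
    define v where "v = (\<lambda>\<xi>. R t f \<xi> - m)"
    have L_v: "L v \<eta> = L (R t f) \<eta>" for \<eta>
      using generator_linear[of 1 "R t f" "-1" "\<lambda>_. m"] by (simp add: v_def generator_const)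
    have "(h has_real_derivative (\<Sum>\<eta>\<in>S. w \<eta> * (2 * (R t f \<eta> - m) * L (R t f) \<eta>))) (at t)"
      unfolding h_def
      by (rule DERIV_sum) (auto intro!: derivative_eq_intros semigroup_deriv)
    also have "(\<Sum>\<eta>\<in>S. w \<eta> * (2 * (R t f \<eta> - m) * L (R t f) \<eta>)) = 2 * ip v (L v)"
      unfolding ip_def sum_distrib_left L_v by (intro sum.cong refl) (simp add: v_def)
    finally have h_deriv: "(h has_real_derivative 2 * ip v (L v)) (at t)" .
    \<comment> \<open>The mean is conserved in time, so subtracting the initial mean
      \<open>m\<close> still centres \<open>R t f\<close>.\<close>
    have "ip (\<lambda>_. 1) v = ip (\<lambda>_. 1) (R t f) - m * Z"
      by (simp add: v_def ip_def Z_def right_diff_distrib sum_subtractf sum_distrib_left mult.commute)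
    also have "\<dots> = 0" using Z_pos by (simp add: semigroup_mean m_def)
    finally have "ip v (L v) \<le> - ip v v" by (rule poincare)
    moreover have "ip v v = h t" by (simp add: ip_def v_def h_def power2_eq_square mult.assoc)
    ultimately have "exp (2 * t) * (2 * ip v (L v) + 2 * h t) \<le> 0"
      by (intro mult_nonneg_nonpos) auto
    moreover have "((\<lambda>t. exp (2 * t) * h t) has_real_derivative
        exp (2 * t) * (2 * ip v (L v) + 2 * h t)) (at t)"
      by (auto intro!: derivative_eq_intros h_deriv simp: algebra_simps)
    ultimately show "\<exists>y. ((\<lambda>t. exp (2 * t) * h t) has_real_derivative y) (at t) \<and> y \<le> 0" by blast
  qed
  then show ?thesis
    by (simp add: h_def semigroup_0 exp_minus field_simps)
qed

text \<open>All weights are positive, so a single term of the L2 sum controls the value at \<eta>.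
  Integer times suffice for identifying the limit.\<close>

lemma semigroup_converges:
  assumes \<eta>: "\<eta> \<in> S"
  shows "(\<lambda>n. R (real n) f \<eta>) \<longlonglongrightarrow> ip (\<lambda>_. 1) f / Z"
proof -
  define m where "m = ip (\<lambda>_. 1) f / Z"
  define V where "V = (\<Sum>\<eta>\<in>S. w \<eta> * (f \<eta> - m)\<^sup>2)"
  have bound: "(R t f \<eta> - m)\<^sup>2 \<le> exp (- 2 * t) * V / w \<eta>" if "t \<ge> 0" for t
  proof -
    have "w \<eta> * (R t f \<eta> - m)\<^sup>2 \<le> (\<Sum>\<eta>\<in>S. w \<eta> * (R t f \<eta> - m)\<^sup>2)"
      using \<eta> w_pos by (intro member_le_sum[of \<eta> S]) (simp_all add: less_imp_le)
    also have "\<dots> \<le> exp (- 2 * t) * V"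
      using semigroup_decay[OF that] by (simp add: V_def m_def)
    finally show ?thesis using w_pos[of \<eta>] by (simp add: field_simps)
  qed
  have "(\<lambda>n. exp (- 2 * real n) * V / w \<eta>) = (\<lambda>n. exp (- 2) ^ n * (V / w \<eta>))"
    by (simp add: exp_of_nat_mult[symmetric] mult.commute)
  also have "\<dots> \<longlonglongrightarrow> 0" by (intro tendsto_mult_left_zero LIMSEQ_realpow_zero) auto
  finally have "(\<lambda>n. (R (real n) f \<eta> - m)\<^sup>2) \<longlonglongrightarrow> 0"
    by (rule tendsto_sandwich[OF _ _ tendsto_const, rotated 2]) (use bound in auto)
  from tendsto_real_sqrt[OF this] have "(\<lambda>n. R (real n) f \<eta> - m) \<longlonglongrightarrow> 0"
    by (simp add: tendsto_rabs_zero_iff)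
  then show ?thesis by (simp add: m_def LIM_zero_iff)
qed

section \<open>Invariant laws\<close>

text \<open>Invariance keeps the expectation of \<open>R (real n) f\<close> equal to that of
  \<open>f\<close>, while the function itself converges to a constant on the finite support. This
  identifies every invariant law with \<open>w\<close> divided by \<open>Z\<close>.\<close>

lemma invariant_expectation:
  assumes inv: "fv_invariant K N p \<nu>"
  shows "measure_pmf.expectation \<nu> f = ip (\<lambda>_. 1) f / Z"
proof -
  have supp: "set_pmf \<nu> \<subseteq> S" using inv by (simp add: fv_invariant_def)
  have exp_eq: "measure_pmf.expectation \<nu> g = (\<Sum>\<eta>\<in>S. g \<eta> * pmf \<nu> \<eta>)" for g :: "(nat \<Rightarrow> nat) \<Rightarrow> real"
    using supp by (intro integral_measure_pmf_real) auto
  have "(\<lambda>n. \<Sum>\<eta>\<in>S. R (real n) f \<eta> * pmf \<nu> \<eta>) \<longlonglongrightarrow> (\<Sum>\<eta>\<in>S. ip (\<lambda>_. 1) f / Z * pmf \<nu> \<eta>)"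
    by (intro tendsto_sum tendsto_mult tendsto_const semigroup_converges)
  moreover have "(\<Sum>\<eta>\<in>S. R (real n) f \<eta> * pmf \<nu> \<eta>) = measure_pmf.expectation \<nu> f" for n
    using inv by (simp add: fv_invariant_def flip: exp_eq)
  ultimately have "measure_pmf.expectation \<nu> f = (\<Sum>\<eta>\<in>S. ip (\<lambda>_. 1) f / Z * pmf \<nu> \<eta>)"
    by (simp add: LIMSEQ_const_iff)
  also have "\<dots> = ip (\<lambda>_. 1) f / Z"
    by (simp only: sum_distrib_left[symmetric] sum_pmf_eq_1[OF finite_configs supp] mult_1_right)
  finally show ?thesis .
qed

lemma invariant_L2_decay:
  assumes inv: "fv_invariant K N p \<nu>" and t: "t \<ge> 0"
  shows "(L2_norm_pmf \<nu> (\<lambda>\<eta>. R t f \<eta> - measure_pmf.expectation \<nu> f))\<^sup>2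
    \<le> exp (- 2 * t) * (L2_norm_pmf \<nu> (\<lambda>\<eta>. f \<eta> - measure_pmf.expectation \<nu> f))\<^sup>2"
proof -
  have norm_eq: "(L2_norm_pmf \<nu> g)\<^sup>2 = (\<Sum>\<eta>\<in>S. w \<eta> * (g \<eta>)\<^sup>2) / Z" for g
  proof -
    have "(L2_norm_pmf \<nu> g)\<^sup>2 = measure_pmf.expectation \<nu> (\<lambda>x. (g x)\<^sup>2)"
      unfolding L2_norm_pmf_def by (intro real_sqrt_pow2 integral_nonneg_AE) simp
    then show ?thesis by (simp add: invariant_expectation[OF inv] ip_def)
  qed
  have "(\<Sum>\<eta>\<in>S. w \<eta> * (R t f \<eta> - ip (\<lambda>_. 1) f / Z)\<^sup>2) / Z
      \<le> exp (- 2 * t) * (\<Sum>\<eta>\<in>S. w \<eta> * (f \<eta> - ip (\<lambda>_. 1) f / Z)\<^sup>2) / Z"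
    using semigroup_decay[OF t] Z_pos by (intro divide_right_mono) auto
  then show ?thesis unfolding norm_eq invariant_expectation[OF inv, of f] by simp
qed

end

theorem mainTheorem3:
  fixes K N :: nat and p :: real
  assumes "K \<ge> 2" and "N \<ge> 2" and "p > 0"
  shows "(neg_generator_eigenvalue K N p 1 \<and>
          (\<forall>l>0. neg_generator_eigenvalue K N p l \<longrightarrow> 1 \<le> l)) \<and>
         (\<forall>\<nu>. fv_invariant K N p \<nu> \<longrightarrow>
           (\<forall>f :: (nat \<Rightarrow> nat) \<Rightarrow> real. \<forall>t\<ge>0.
             (L2_norm_pmf \<nu> (\<lambda>\<eta>. fv_semigroup K N p t f \<eta> - measure_pmf.expectation \<nu> f))\<^sup>2
               \<le> exp (- 2 * t) *
                 (L2_norm_pmf \<nu> (\<lambda>\<eta>. f \<eta> - measure_pmf.expectation \<nu> f))\<^sup>2))"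
proof -
  interpret fleming_viot K N p by unfold_locales (fact assms)+
  show ?thesis
    using eigenvalue_1 eigenvalue_ge_1 invariant_L2_decay by blast
qed

end
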